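(* Let $r,s\ge 1$ be integers with $r$ odd and $s$ even, let $b\in\mathbb{R}$ with $b>0$, and put $$u_0=y,\qquad u_1=x-b x^{r}y^{s}.$$ Let $F=(F_1,F_2):\mathbb{R}^2\to\mathbb{R}^2$ be a polynomial map such that each of $F_1$ and $F_2$ can be written as a finite sum $$\sum_{\alpha,\beta}a_{\alpha\beta}\,u_0^{\alpha}u_1^{\beta},\qquad a_{\alpha\beta}\in\mathbb{R}$$ (with nonnegative integer exponents $\alpha,\beta$ and with coefficients depending on the component). Then $F$ satisfies the Jacobian conjecture.
   Context: A polynomial map $F:\mathbb{R}^2\to\mathbb{R}^2$ satisfies the Jacobian condition if there is a constant $c\in\mathbb{R}\setminus\{0\}$ such that $\det JF(x,y)=c$ for all $(x,y)\in\mathbb{R}^2$, where $JF(x,y)$ is the Jacobian matrix of $F$ at $(x,y)$. One says that $F$ satisfies the Jacobian conjecture if the following implication holds: if $F$ satisfies the Jacobian condition, then $F$ is a polynomial automorphism of $\mathbb{R}^2$ (a bijective polynomial map with polynomial inverse). *)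

theory Defs
  imports "HOL-Analysis.Analysis"
begin

(* The plane is real^2 with coordinates x = p $ 1 and y = p $ 2.  Over the reals a polynomial
   is determined by the function it induces, so polynomial maps are the maps satisfying
   polynomial_function, and identities between polynomials are identities of functions. *)

definition jacobian_condition :: "(real^2 \<Rightarrow> real^2) \<Rightarrow> bool" where
  "jacobian_condition F \<longleftrightarrow> (\<exists>c. c \<noteq> 0 \<and> (\<forall>p. det (jacobian F (at p)) = c))"

definition polynomial_automorphism :: "(real^2 \<Rightarrow> real^2) \<Rightarrow> bool" where
  "polynomial_automorphism F \<longleftrightarrow>
     polynomial_function F \<and> bij F \<and> polynomial_function (inv F)"

(* Meant for polynomial maps F only. *)
definition satisfies_jacobian_conjecture :: "(real^2 \<Rightarrow> real^2) \<Rightarrow> bool" where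
  "satisfies_jacobian_conjecture F \<longleftrightarrow>
     (jacobian_condition F \<longrightarrow> polynomial_automorphism F)"

end

theory Submission
  imports Defs
begin

text \<open>
  The hypothesis of the implication is never met. Write \<open>e\<^sub>1 = (1, 0)\<close>. The derivative of \<open>y\<close> along
  \<open>e\<^sub>1\<close> is \<open>0\<close>, and that of \<open>x - b x^r y^s\<close> is \<open>1 - b r x^(r-1) y^s\<close>. Since \<open>b > 0\<close> and \<open>s \<ge> 1\<close>, the
  latter vanishes at the point \<open>(1, t)\<close> with \<open>t\<close> the positive \<open>s\<close>-th root of \<open>1 / (b r)\<close>. There, by
  the chain rule, every polynomial expression in the two functions is stationary along \<open>e\<^sub>1\<close>
  (\<open>stationary_along_polynomial\<close>). Hence \<open>e\<^sub>1\<close> lies in the kernel of the Jacobian matrix of \<open>F\<close> at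
  that point (\<open>det_jacobian_eq_0_if_stationary\<close>), so that the Jacobian determinant has a real zero
  and cannot be a nonzero constant.
\<close>

text \<open>
  Differentiability is part of the notion, so that it is preserved by the operations below and
  does not have to be carried along separately.
\<close>

definition stationary_along :: "('a::real_normed_vector \<Rightarrow> 'b::real_normed_vector) \<Rightarrow> 'a \<Rightarrow> 'a \<Rightarrow> bool"
  where "stationary_along f p v \<longleftrightarrow> (\<exists>D. (f has_derivative D) (at p) \<and> D v = 0)"

lemma stationary_along_const: "stationary_along (\<lambda>_. c) p v"
  unfolding stationary_along_def by (intro exI[of _ "\<lambda>_. 0"]) auto

lemma stationary_along_mult:
  fixes f g :: "'a::real_normed_vector \<Rightarrow> 'b::real_normed_algebra"
  assumes "stationary_along f p v" and "stationary_along g p v"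
  shows "stationary_along (\<lambda>x. f x * g x) p v"
proof -
  obtain D E where "(f has_derivative D) (at p)" "D v = 0" "(g has_derivative E) (at p)" "E v = 0"
    using assms unfolding stationary_along_def by blast
  then show ?thesis
    unfolding stationary_along_def
    by (intro exI[of _ "\<lambda>h. f p * E h + D h * g p"] conjI has_derivative_mult) auto
qed

lemma stationary_along_power:
  fixes f :: "'a::real_normed_vector \<Rightarrow> 'b::real_normed_algebra_1"
  assumes "stationary_along f p v"
  shows "stationary_along (\<lambda>x. f x ^ n) p v"
  by (induction n) (simp_all add: stationary_along_const stationary_along_mult assms)

lemma stationary_along_sum:
  assumes "\<And>i. i \<in> A \<Longrightarrow> stationary_along (f i) p v"
  shows "stationary_along (\<lambda>x. \<Sum>i\<in>A. f i x) p v"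
proof -
  have "\<forall>i\<in>A. \<exists>D. (f i has_derivative D) (at p) \<and> D v = 0"
    using assms unfolding stationary_along_def by blast
  then obtain D where "\<forall>i\<in>A. (f i has_derivative D i) (at p) \<and> D i v = 0"
    by (auto dest: bchoice)
  then show ?thesis
    unfolding stationary_along_def
    by (intro exI[of _ "\<lambda>h. \<Sum>i\<in>A. D i h"] conjI has_derivative_sum) auto
qed

lemma stationary_along_polynomial:
  fixes u w :: "'a::real_normed_vector \<Rightarrow> real"
  assumes "stationary_along u p v" and "stationary_along w p v"
  shows "stationary_along (\<lambda>x. \<Sum>(\<alpha>, \<beta>)\<in>A. a \<alpha> \<beta> * u x ^ \<alpha> * w x ^ \<beta>) p v"
  unfolding case_prod_unfold
  by (intro stationary_along_sum stationary_along_mult stationary_along_power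
      stationary_along_const assms)

lemma stationary_along_vec:
  fixes F :: "'a::real_normed_vector \<Rightarrow> real^'n"
  assumes "\<And>i. stationary_along (\<lambda>x. F x $ i) p v"
  shows "stationary_along F p v"
proof -
  obtain D where D: "\<And>i. ((\<lambda>x. F x $ i) has_derivative D i) (at p)" "\<And>i. D i v = 0"
    using assms unfolding stationary_along_def by metis
  have "(F has_derivative (\<lambda>h. \<chi> i. D i h)) (at p)"
    unfolding has_derivative_componentwise_within[of F]
    using D(1) by (auto simp: Basis_vec_def inner_axis)
  then show ?thesis
    unfolding stationary_along_def using D(2) by (auto simp: vec_eq_iff)
qed

text \<open>The Jacobian matrix sends \<open>v\<close> to \<open>0\<close>, so it is not invertible.\<close>

lemma det_jacobian_eq_0_if_stationary:
  fixes F :: "real^'n \<Rightarrow> real^'n"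
  assumes "stationary_along F p v" and "v \<noteq> 0"
  shows "det (jacobian F (at p)) = 0"
proof -
  obtain D where D: "(F has_derivative D) (at p)" "D v = 0"
    using assms(1) unfolding stationary_along_def by blast
  have "jacobian F (at p) = matrix D"
    unfolding jacobian_def using frechet_derivative_at[OF D(1)] by simp
  then have "jacobian F (at p) *v v = 0"
    using D by (simp add: has_derivative_linear matrix_works)
  then have "\<not> invertible (jacobian F (at p))"
    using assms(2) by (metis invertible_left_inverse matrix_left_invertible_ker)
  then show ?thesis
    by (simp add: invertible_det_nz)
qed

text \<open>
  On the line \<open>x = 1\<close> the derivative \<open>1 - b r x^(r-1) y^s\<close> along \<open>e\<^sub>1\<close> becomes \<open>1 - b r y^s\<close>, so the
  assumption says exactly that it vanishes at \<open>(1, t)\<close>.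
\<close>

lemma stationary_along_x_minus_monomial:
  fixes b t :: real and r s :: nat
  assumes "b * real r * t ^ s = 1"
  shows "stationary_along (\<lambda>p::real^2. p $ 1 - b * (p $ 1) ^ r * (p $ 2) ^ s)
           (vector [1, t]) (axis 1 1)"
proof -
  have coord: "((\<lambda>p::real^2. p $ i) has_derivative (\<lambda>h. h $ i)) (at q)" for i q
    by (intro bounded_linear.has_derivative[OF bounded_linear_vec_nth has_derivative_ident])
  show ?thesis
    unfolding stationary_along_def
    using assms
    by (intro exI conjI) (rule derivative_eq_intros coord refl | simp add: axis_def algebra_simps)+
qed

theorem corollary2p22:
  fixes r s :: nat and b :: real
    and u0 u1 :: "real^2 \<Rightarrow> real"
    and F :: "real^2 \<Rightarrow> real^2"
  assumes "r \<ge> 1" and "s \<ge> 1" and "odd r" and "even s" and "b > 0"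
    and "u0 = (\<lambda>p. p $ 2)"
    and "u1 = (\<lambda>p. p $ 1 - b * (p $ 1) ^ r * (p $ 2) ^ s)"
    and "polynomial_function F"
    and "\<forall>i. \<exists>(A :: (nat \<times> nat) set) (a :: nat \<Rightarrow> nat \<Rightarrow> real). finite A \<and>
           (\<forall>p. F p $ i = (\<Sum>(\<alpha>, \<beta>)\<in>A. a \<alpha> \<beta> * u0 p ^ \<alpha> * u1 p ^ \<beta>))"
  shows "satisfies_jacobian_conjecture F"
proof -
  define t where "t = root s (1 / (b * real r))"
  define q :: "real^2" where "q = vector [1, t]"
  have "t ^ s = 1 / (b * real r)"
    unfolding t_def using assms(1,2,5) by (intro real_root_pow_pos2) auto
  then have "b * real r * t ^ s = 1"
    using assms(1,5) by simp
  then have u1: "stationary_along u1 q (axis 1 1)"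
    unfolding assms(7) q_def by (rule stationary_along_x_minus_monomial)
  have u0: "stationary_along u0 q (axis 1 1)"
    unfolding assms(6) stationary_along_def
    by (intro exI[of _ "\<lambda>h. h $ 2"] conjI
        bounded_linear.has_derivative[OF bounded_linear_vec_nth has_derivative_ident])
      (simp add: axis_def)
  have "stationary_along (\<lambda>p. F p $ i) q (axis 1 1)" for i
  proof -
    obtain A a where "\<forall>p. F p $ i = (\<Sum>(\<alpha>, \<beta>)\<in>A. a \<alpha> \<beta> * u0 p ^ \<alpha> * u1 p ^ \<beta>)"
      using assms(9) by meson
    then show ?thesis
      using stationary_along_polynomial[OF u0 u1, of a A] by simp
  qed
  then have "det (jacobian F (at q)) = 0"
    by (intro det_jacobian_eq_0_if_stationary[where v = "axis 1 1"] stationary_along_vec)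
      (simp_all add: axis_eq_0_iff)
  then have "\<not> jacobian_condition F"
    unfolding jacobian_condition_def by metis
  then show ?thesis
    unfolding satisfies_jacobian_conjecture_def by blast
qed

end
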